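(* There exists no conjugate pair on $(SPD(n),g_W)$; that is, there is no geodesic $\gamma$ of $(SPD(n),g_W)$ together with a Jacobi field $J\not\equiv 0$ along $\gamma$ that vanishes at two distinct parameter values of $\gamma$.
   Context: $SPD(n)$ is the set of real symmetric positive-definite $n\times n$ matrices, an open subset of the space $Sym(n)$ of real symmetric matrices, so $T_ASPD(n)\cong Sym(n)$. For $A\in SPD(n)$ and a real $n\times n$ matrix $X$, $\Gamma_A[X]$ denotes the unique real matrix satisfying $A\,\Gamma_A[X]+\Gamma_A[X]\,A=X$. The Wasserstein metric is the Riemannian metric $g_W|_A(X,Y)=\mathrm{tr}(\Gamma_A[Y]\,A\,\Gamma_A[X])=\frac12\mathrm{tr}(\Gamma_A[Y]X)$ for $X,Y\in T_ASPD(n)$. Geodesics are non-constant. *)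

theory Defs
  imports "HOL-Analysis.Analysis"
begin

text \<open>
  Riemannian geometry of a manifold \<open>U\<close> that is a (relatively) open subset of a linear
  subspace \<open>V\<close> of a Euclidean space, so that every tangent space is \<open>V\<close>. A metric is a
  function \<open>g p x y\<close> of a point \<open>p\<close> of \<open>U\<close> and tangent vectors \<open>x\<close>, \<open>y\<close> in \<open>V\<close>; its values
  elsewhere are irrelevant. All derivatives of tensors are taken in directions of \<open>V\<close>,
  hence stay in \<open>U\<close>.
\<close>

definition dir_deriv ::
    "('a::real_normed_vector \<Rightarrow> 'b::real_normed_vector) \<Rightarrow> 'a \<Rightarrow> 'a \<Rightarrow> 'b" where
  "dir_deriv f p x = vector_derivative (\<lambda>t::real. f (p + t *\<^sub>R x)) (at 0)"

text \<open>
  \<open>C x y\<close> is the value at \<open>p\<close> of the covariant derivative of the constant field \<open>y\<close> in the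
  direction \<open>x\<close>. Constant fields commute, so the second condition is vanishing of the torsion;
  the third one is compatibility with the metric.
\<close>

definition levi_civita_at ::
    "'a::euclidean_space set \<Rightarrow> ('a \<Rightarrow> 'a \<Rightarrow> 'a \<Rightarrow> real) \<Rightarrow> 'a \<Rightarrow> ('a \<Rightarrow> 'a \<Rightarrow> 'a) \<Rightarrow> bool" where
  "levi_civita_at V g p C \<longleftrightarrow>
     (\<forall>x\<in>V. \<forall>y\<in>V. C x y \<in> V) \<and>
     (\<forall>x\<in>V. \<forall>y\<in>V. C x y = C y x) \<and>
     (\<forall>x\<in>V. \<forall>y\<in>V. \<forall>z\<in>V.
        dir_deriv (\<lambda>q. g q y z) p x = g p (C x y) z + g p y (C x z))"

definition christoffel ::
    "'a::euclidean_space set \<Rightarrow> ('a \<Rightarrow> 'a \<Rightarrow> 'a \<Rightarrow> real) \<Rightarrow> 'a \<Rightarrow> 'a \<Rightarrow> 'a \<Rightarrow> 'a" where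
  "christoffel V g p x y = (THE z. \<exists>C. levi_civita_at V g p C \<and> z = C x y)"

definition nabla ::
    "'a::euclidean_space set \<Rightarrow> ('a \<Rightarrow> 'a \<Rightarrow> 'a \<Rightarrow> real) \<Rightarrow> ('a \<Rightarrow> 'a) \<Rightarrow> ('a \<Rightarrow> 'a) \<Rightarrow> 'a \<Rightarrow> 'a" where
  "nabla V g X Y p = dir_deriv Y p (X p) + christoffel V g p (X p) (Y p)"

definition lie_bracket :: "('a::euclidean_space \<Rightarrow> 'a) \<Rightarrow> ('a \<Rightarrow> 'a) \<Rightarrow> 'a \<Rightarrow> 'a" where
  "lie_bracket X Y p = dir_deriv Y p (X p) - dir_deriv X p (Y p)"

definition curvature_field ::
    "'a::euclidean_space set \<Rightarrow> ('a \<Rightarrow> 'a \<Rightarrow> 'a \<Rightarrow> real) \<Rightarrow>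
     ('a \<Rightarrow> 'a) \<Rightarrow> ('a \<Rightarrow> 'a) \<Rightarrow> ('a \<Rightarrow> 'a) \<Rightarrow> 'a \<Rightarrow> 'a" where
  "curvature_field V g X Y Z p =
     nabla V g X (nabla V g Y Z) p - nabla V g Y (nabla V g X Z) p
     - nabla V g (lie_bracket X Y) Z p"

text \<open>Being tensorial, the curvature may be evaluated on constant extensions.\<close>

definition curvature ::
    "'a::euclidean_space set \<Rightarrow> ('a \<Rightarrow> 'a \<Rightarrow> 'a \<Rightarrow> real) \<Rightarrow> 'a \<Rightarrow> 'a \<Rightarrow> 'a \<Rightarrow> 'a \<Rightarrow> 'a" where
  "curvature V g p x y z = curvature_field V g (\<lambda>_. x) (\<lambda>_. y) (\<lambda>_. z) p"

definition velocity :: "(real \<Rightarrow> 'a::real_normed_vector) \<Rightarrow> real \<Rightarrow> 'a" where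
  "velocity \<gamma> t = vector_derivative \<gamma> (at t)"

definition cov_deriv_along ::
    "'a::euclidean_space set \<Rightarrow> ('a \<Rightarrow> 'a \<Rightarrow> 'a \<Rightarrow> real) \<Rightarrow>
     (real \<Rightarrow> 'a) \<Rightarrow> (real \<Rightarrow> 'a) \<Rightarrow> real \<Rightarrow> 'a" where
  "cov_deriv_along V g \<gamma> W t =
     vector_derivative W (at t) + christoffel V g (\<gamma> t) (velocity \<gamma> t) (W t)"

text \<open>
  Geodesics are non-constant and are parametrised by an open interval, possibly unbounded.
  Twice differentiable solutions of the geodesic and Jacobi equations of a smooth metric are
  automatically smooth.
\<close>

definition geodesic ::
    "'a::euclidean_space set \<Rightarrow> 'a set \<Rightarrow> ('a \<Rightarrow> 'a \<Rightarrow> 'a \<Rightarrow> real) \<Rightarrow>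
     real set \<Rightarrow> (real \<Rightarrow> 'a) \<Rightarrow> bool" where
  "geodesic V U g I \<gamma> \<longleftrightarrow>
     open I \<and> is_interval I \<and> \<gamma> ` I \<subseteq> U \<and>
     (\<forall>t\<in>I. \<gamma> differentiable (at t)) \<and>
     (\<forall>t\<in>I. velocity \<gamma> differentiable (at t)) \<and>
     (\<forall>t\<in>I. cov_deriv_along V g \<gamma> (velocity \<gamma>) t = 0) \<and>
     \<not> \<gamma> constant_on I"

definition jacobi_field ::
    "'a::euclidean_space set \<Rightarrow> ('a \<Rightarrow> 'a \<Rightarrow> 'a \<Rightarrow> real) \<Rightarrow>
     real set \<Rightarrow> (real \<Rightarrow> 'a) \<Rightarrow> (real \<Rightarrow> 'a) \<Rightarrow> bool" where
  "jacobi_field V g I \<gamma> J \<longleftrightarrow>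
     J ` I \<subseteq> V \<and>
     (\<forall>t\<in>I. J differentiable (at t)) \<and>
     (\<forall>t\<in>I. cov_deriv_along V g \<gamma> J differentiable (at t)) \<and>
     (\<forall>t\<in>I. cov_deriv_along V g \<gamma> (cov_deriv_along V g \<gamma> J) t
             + curvature V g (\<gamma> t) (J t) (velocity \<gamma> t) (velocity \<gamma> t) = 0)"

definition Sym :: "(real^'n^'n) set" where
  "Sym = {A. transpose A = A}"

definition SPD :: "(real^'n^'n) set" where
  "SPD = {A \<in> Sym. \<forall>x. x \<noteq> 0 \<longrightarrow> 0 < x \<bullet> (A *v x)}"

definition lyapunov :: "real^'n^'n \<Rightarrow> real^'n^'n \<Rightarrow> real^'n^'n" where
  "lyapunov A X = (THE G. A ** G + G ** A = X)"

definition wasserstein :: "real^'n^'n \<Rightarrow> real^'n^'n \<Rightarrow> real^'n^'n \<Rightarrow> real" where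
  "wasserstein A X Y = trace (lyapunov A Y ** A ** lyapunov A X)"

end

theory Submission imports Defs begin

text \<open>
  Write \<open>x = \<Gamma>[\<gamma>']\<close>. The Christoffel symbol of the metric is \<open>- (x A y + y A x)\<close> with
  \<open>x = \<Gamma>[X]\<close>, \<open>y = \<Gamma>[Y]\<close>, so the geodesic equation becomes \<open>x' = - x\<^sup>2\<close>. The Jacobi equation is
  its linearisation: with \<open>k = \<Gamma>[J' - J x - x J]\<close> it reads \<open>J' = J x + x J + \<gamma> k + k \<gamma>\<close> and
  \<open>k' = - (k x + x k)\<close>. Hence \<open>tr (J k)\<close> has derivative \<open>2 tr (k \<gamma> k)\<close>, which is positive wherever
  \<open>k\<close> does not vanish. If \<open>J\<close> vanishes twice, so does \<open>tr (J k)\<close>, and therefore \<open>k\<close> vanishes at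
  some point in between. Both equations being linear, \<open>k\<close> and then \<open>J\<close> vanish identically.
\<close>

subsection \<open>Matrix algebra\<close>

lemma bounded_bilinear_matrix_matrix_mult:
  "bounded_bilinear ((**) :: real^'n^'m \<Rightarrow> real^'p^'n \<Rightarrow> real^'p^'m)"
proof -
  have "bilinear ((**) :: real^'n^'m \<Rightarrow> real^'p^'n \<Rightarrow> real^'p^'m)"
    by (auto simp: bilinear_def linear_iff vec_eq_iff matrix_matrix_mult_def sum.distrib
        sum_distrib_left distrib_left distrib_right mult.assoc mult.left_commute)
  then show ?thesis
    by (simp add: bilinear_conv_bounded_bilinear)
qed

interpretation matrix_mult:
  bounded_bilinear "(**) :: real^'n^'m \<Rightarrow> real^'p^'n \<Rightarrow> real^'p^'m"
  by (rule bounded_bilinear_matrix_matrix_mult)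

lemma bounded_linear_trace: "bounded_linear (trace :: real^'n^'n \<Rightarrow> real)"
  by (auto simp: linear_conv_bounded_linear[symmetric] linear_iff trace_def sum.distrib
      sum_distrib_left)

lemmas trace_minus = linear_neg[OF bounded_linear.linear[OF bounded_linear_trace]]
  and trace_zero = linear_0[OF bounded_linear.linear[OF bounded_linear_trace]]

lemma bounded_linear_transpose: "bounded_linear (transpose :: real^'n^'m \<Rightarrow> real^'m^'n)"
  by (auto simp: linear_conv_bounded_linear[symmetric] linear_iff transpose_def vec_eq_iff)

lemmas transpose_add = linear_add[OF bounded_linear.linear[OF bounded_linear_transpose]]
  and transpose_diff = linear_diff[OF bounded_linear.linear[OF bounded_linear_transpose]]
  and transpose_minus = linear_neg[OF bounded_linear.linear[OF bounded_linear_transpose]]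
  and transpose_scaleR = linear_scale[OF bounded_linear.linear[OF bounded_linear_transpose]]
  and transpose_zero = linear_0[OF bounded_linear.linear[OF bounded_linear_transpose]]

lemmas matrix_ring_simps =
  matrix_mult.add_left matrix_mult.add_right matrix_mult.diff_left matrix_mult.diff_right
  matrix_mult.minus_left matrix_mult.minus_right matrix_mult.scaleR_left matrix_mult.scaleR_right
  matrix_mul_assoc

lemma trace_transpose: "trace (transpose A) = trace A"
  by (simp add: trace_def transpose_def)

lemma trace_transpose_mult_self: "trace (transpose A ** A) = A \<bullet> A" for A :: "real^'n^'n"
proof -
  have "trace (transpose A ** A) = (\<Sum>i\<in>UNIV. \<Sum>k\<in>UNIV. A $ k $ i * A $ k $ i)"
    by (simp add: trace_def matrix_matrix_mult_def transpose_def)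
  also have "\<dots> = (\<Sum>k\<in>UNIV. \<Sum>i\<in>UNIV. A $ k $ i * A $ k $ i)"
    by (rule sum.swap)
  finally show ?thesis
    by (simp add: inner_vec_def)
qed

lemma trace_congruence:
  "trace (transpose G ** A ** G) = (\<Sum>j\<in>UNIV. column j G \<bullet> (A *v column j G))"
  for A G :: "real^'n^'n"
proof -
  have "(transpose G ** (A ** G)) $ j $ j = column j G \<bullet> (A *v column j G)" for j
    by (simp add: matrix_matrix_mult_def transpose_def column_def inner_vec_def
        matrix_vector_mult_def)
  then show ?thesis
    by (simp add: trace_def matrix_mul_assoc)
qed

text \<open>The trace sums the quadratic form of \<open>A\<close> over the columns of
  \<open>G\<close>, one of which is nonzero. This positivity gives both the solvability of the
  Lyapunov equation on \<open>SPD\<close> and, at the end, a zero of \<open>k\<close>.\<close>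

lemma trace_congruence_pos:
  fixes A G :: "real^'n^'n"
  assumes A: "A \<in> SPD" and "G \<noteq> 0"
  shows "0 < trace (transpose G ** A ** G)"
proof -
  obtain j where j: "column j G \<noteq> 0"
    using \<open>G \<noteq> 0\<close> by (auto simp: vec_eq_iff column_def)
  have pos: "0 < x \<bullet> (A *v x)" if "x \<noteq> 0" for x
    using A that by (auto simp: SPD_def)
  have nonneg: "0 \<le> x \<bullet> (A *v x)" for x
    using pos[of x] by (cases "x = 0") auto
  show ?thesis
    unfolding trace_congruence
    by (rule sum_pos2[of _ j]) (auto simp: pos j nonneg)
qed

lemma Sym_add: "A \<in> Sym \<Longrightarrow> B \<in> Sym \<Longrightarrow> A + B \<in> Sym"
  and Sym_diff: "A \<in> Sym \<Longrightarrow> B \<in> Sym \<Longrightarrow> A - B \<in> Sym"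
  and Sym_minus: "A \<in> Sym \<Longrightarrow> - A \<in> Sym"
  and Sym_scaleR: "A \<in> Sym \<Longrightarrow> c *\<^sub>R A \<in> Sym"
  and Sym_zero: "0 \<in> Sym"
  for A B :: "real^'n^'n"
  by (auto simp: Sym_def transpose_add transpose_diff transpose_minus
      transpose_scaleR transpose_zero)

lemma Sym_transpose: "A \<in> Sym \<Longrightarrow> transpose A = A"
  by (simp add: Sym_def)

lemma Sym_anticommutator:
  fixes A B :: "real^'n^'n"
  assumes "A \<in> Sym" "B \<in> Sym"
  shows "A ** B + B ** A \<in> Sym"
  using assms by (simp add: Sym_def transpose_add matrix_transpose_mul add.commute)

lemma Sym_sandwich:
  fixes A B C :: "real^'n^'n"
  assumes "A \<in> Sym" "B \<in> Sym" "C \<in> Sym"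
  shows "A ** B ** C + C ** B ** A \<in> Sym"
  using assms
  by (simp add: Sym_def transpose_add matrix_transpose_mul matrix_mul_assoc add.commute)

lemma subspace_Sym: "subspace (Sym :: (real^'n^'n) set)"
  by (auto simp: subspace_def Sym_zero Sym_add Sym_scaleR)

lemmas Sym_intros = Sym_add Sym_diff Sym_minus Sym_scaleR Sym_zero Sym_anticommutator Sym_sandwich

subsection \<open>The Lyapunov equation\<close>

text \<open>Seen as an operator in \<open>G\<close>, its injectivity is unique solvability of the
  Lyapunov equation. The same expression also abbreviates sums such as \<open>J x + x J\<close>,
  where nothing is solved.\<close>

definition anticomm :: "real^'n^'n \<Rightarrow> real^'n^'n \<Rightarrow> real^'n^'n" where
  "anticomm A G = A ** G + G ** A"

lemma bounded_linear_anticomm: "bounded_linear (anticomm A)"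
  unfolding anticomm_def
  by (intro bounded_linear_add matrix_mult.bounded_linear_right matrix_mult.bounded_linear_left)

lemmas anticomm_add = linear_add[OF bounded_linear.linear[OF bounded_linear_anticomm]]
  and anticomm_diff = linear_diff[OF bounded_linear.linear[OF bounded_linear_anticomm]]
  and anticomm_scaleR = linear_scale[OF bounded_linear.linear[OF bounded_linear_anticomm]]
  and linear_anticomm = bounded_linear.linear[OF bounded_linear_anticomm]

text \<open>
  The Lyapunov equation is uniquely solvable on a relatively open subset of \<open>Sym\<close>; working there
  instead of on \<open>SPD\<close> spares us the openness of \<open>SPD\<close>.
\<close>

definition lyapunov_regular :: "(real^'n^'n) set" where
  "lyapunov_regular = {A \<in> Sym. inj (anticomm A)}"

text \<open>Pairing \<open>A G + G A\<close> with \<open>G\<close> under the trace gives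
  \<open>tr (G^T A G) + tr (G A G^T)\<close>, and both terms are positive unless \<open>G\<close> is
  \<open>0\<close>.\<close>

lemma SPD_imp_regular:
  fixes A :: "real^'n^'n"
  assumes A: "A \<in> SPD"
  shows "A \<in> lyapunov_regular"
proof -
  have "G = 0" if "anticomm A G = 0" for G
  proof (rule ccontr)
    assume "G \<noteq> 0"
    then have "transpose G \<noteq> 0"
      by (metis transpose_zero transpose_transpose)
    have "trace (transpose G ** anticomm A G)
        = trace (transpose G ** A ** G) + trace (transpose (transpose G) ** A ** transpose G)"
      using trace_mul_sym[of "transpose G" "G ** A"]
      by (simp add: anticomm_def matrix_ring_simps trace_add)
    also have "\<dots> > 0"
      by (intro add_pos_pos trace_congruence_pos A \<open>G \<noteq> 0\<close> \<open>transpose G \<noteq> 0\<close>)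
    finally show False
      by (simp add: that matrix_mult.zero_right trace_def)
  qed
  then show ?thesis
    using A by (simp add: lyapunov_regular_def SPD_def
        linear_injective_0[OF linear_anticomm])
qed

text \<open>An injective endomorphism of a finite-dimensional space is surjective, so the
  \<open>THE\<close> in \<open>lyapunov\<close> is well defined.\<close>

lemma anticomm_lyapunov:
  assumes "inj (anticomm A)"
  shows "anticomm A (lyapunov A X) = X"
    and lyapunov_unique: "anticomm A G = X \<Longrightarrow> lyapunov A X = G"
proof -
  have "surj (anticomm A)"
    using linear_injective_imp_surjective assms linear_anticomm
    by blast
  then obtain H where H: "X = anticomm A H" by blast
  have "lyapunov A X = H"
    unfolding lyapunov_def anticomm_def[symmetric]
    using H injD[OF assms] by blast
  then show "anticomm A (lyapunov A X) = X"
    using H by simp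
  show "lyapunov A X = G" if "anticomm A G = X"
    using \<open>lyapunov A X = H\<close> that H injD[OF assms] by metis
qed

lemma linear_lyapunov: "inj (anticomm A) \<Longrightarrow> linear (lyapunov A)"
  by (rule linearI; rule lyapunov_unique)
    (simp_all add: anticomm_add anticomm_scaleR anticomm_lyapunov)

text \<open>The transpose of the solution solves the same equation, since \<open>A\<close> and
  \<open>X\<close> are symmetric; uniqueness identifies the two.\<close>

lemma lyapunov_in_Sym:
  assumes "A \<in> lyapunov_regular" "X \<in> Sym"
  shows "lyapunov A X \<in> Sym"
proof -
  have inj: "inj (anticomm A)" and "A \<in> Sym"
    using assms by (auto simp: lyapunov_regular_def)
  then have "anticomm A (transpose (lyapunov A X)) = transpose (anticomm A (lyapunov A X))"
    by (simp add: anticomm_def transpose_add matrix_transpose_mul Sym_transpose add.commute)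
  also have "\<dots> = X"
    using assms by (simp add: anticomm_lyapunov[OF inj] Sym_def)
  finally have "lyapunov A X = transpose (lyapunov A X)"
    by (rule lyapunov_unique[OF inj])
  then show ?thesis
    unfolding Sym_def by (intro CollectI) (rule sym)
qed

text \<open>An injective operator satisfies a lower bound with some constant \<open>B\<close>, and
  half of it survives a small perturbation of \<open>A\<close>. This gives injectivity nearby
  together with a uniform bound on the inverses.\<close>

lemma tendsto_lyapunov:
  fixes A X :: "'a \<Rightarrow> real^'n^'n"
  assumes A: "(A \<longlongrightarrow> A0) F" and X: "(X \<longlongrightarrow> X0) F" and inj: "inj (anticomm A0)"
  shows eventually_inj_anticomm: "eventually (\<lambda>s. inj (anticomm (A s))) F"
    and "((\<lambda>s. lyapunov (A s) (X s)) \<longlongrightarrow> lyapunov A0 X0) F"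
proof -
  obtain B where "B > 0" and B: "B * norm G \<le> norm (anticomm A0 G)" for G
    using linear_inj_bounded_below_pos[OF linear_anticomm inj]
    by blast
  obtain K where "K > 0" and K: "norm (P ** Q) \<le> norm P * norm Q * K" for P Q :: "real^'n^'n"
    using matrix_mult.pos_bounded by blast
  \<comment> \<open>\<open>K\<close> bounds the matrix product, so this radius keeps the
    perturbation of \<open>anticomm A0 G\<close> below
    \<open>2 * K * (B / (4 * K)) * norm G\<close>, which is half of the lower bound.\<close>
  have "eventually (\<lambda>s. norm (A s - A0) < B / (4 * K)) F"
    using tendstoD[OF A, of "B / (4 * K)"] \<open>B > 0\<close> \<open>K > 0\<close> by (simp add: dist_norm)
  then have bound: "eventually (\<lambda>s. \<forall>G. B / 2 * norm G \<le> norm (anticomm (A s) G)) F"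
  proof (rule eventually_mono, intro allI)
    fix s G assume s: "norm (A s - A0) < B / (4 * K)"
    define E where "E = (A s - A0) ** G + G ** (A s - A0)"
    have split: "anticomm (A s) G = anticomm A0 G + E"
      by (simp add: anticomm_def E_def matrix_mult.diff_left matrix_mult.diff_right)
    have "norm E \<le> 2 * K * norm (A s - A0) * norm G"
      unfolding E_def using K[of "A s - A0" G] K[of G "A s - A0"]
      by (intro norm_triangle_le) (simp add: mult_ac)
    also have "\<dots> \<le> B / 2 * norm G"
      using s \<open>K > 0\<close> by (intro mult_right_mono) (auto simp: pos_less_divide_eq mult_ac)
    finally have "norm E \<le> B / 2 * norm G" .
    moreover have "norm (anticomm A0 G) - norm E \<le> norm (anticomm (A s) G)"
      unfolding split by (rule norm_diff_ineq)
    ultimately show "B / 2 * norm G \<le> norm (anticomm (A s) G)"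
      using B[of G] by simp
  qed
  show ev: "eventually (\<lambda>s. inj (anticomm (A s))) F"
    using bound
  proof (rule eventually_mono)
    fix s assume "\<forall>G. B / 2 * norm G \<le> norm (anticomm (A s) G)"
    then have "B / 2 * norm G \<le> 0" if "anticomm (A s) G = 0" for G
      using that by (metis norm_zero)
    then have "G = 0" if "anticomm (A s) G = 0" for G
      using that \<open>B > 0\<close> by (simp add: mult_le_0_iff)
    then show "inj (anticomm (A s))"
      by (simp add: linear_injective_0[OF linear_anticomm])
  qed
  define G where "G = lyapunov A0 X0"
  \<comment> \<open>The error is controlled by the residual of the fixed limit \<open>G\<close> in
    the equation at \<open>s\<close>, and this residual tends to \<open>0\<close>.\<close>
  have "eventually (\<lambda>s. norm (lyapunov (A s) (X s) - G)
      \<le> norm (X s - (A s ** G + G ** A s)) * (2 / B)) F"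
    using bound ev
  proof eventually_elim
    case (elim s)
    have "anticomm (A s) (lyapunov (A s) (X s) - G) = X s - (A s ** G + G ** A s)"
      using elim(2) by (simp add: anticomm_diff anticomm_lyapunov) (simp add: anticomm_def)
    then have "B / 2 * norm (lyapunov (A s) (X s) - G) \<le> norm (X s - (A s ** G + G ** A s))"
      using elim(1) by metis
    then show ?case
      using \<open>B > 0\<close> by (simp add: pos_le_divide_eq mult.commute)
  qed
  moreover have "((\<lambda>s. norm (X s - (A s ** G + G ** A s)) * (2 / B)) \<longlongrightarrow>
      norm (X0 - (A0 ** G + G ** A0)) * (2 / B)) F"
    by (intro tendsto_intros A X matrix_mult.tendsto)
  moreover have "A0 ** G + G ** A0 = X0"
    unfolding G_def using anticomm_lyapunov[OF inj] by (simp add: anticomm_def)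
  ultimately have "((\<lambda>s. lyapunov (A s) (X s) - G) \<longlongrightarrow> 0) F"
    by (auto elim: Lim_null_comparison)
  then show "((\<lambda>s. lyapunov (A s) (X s)) \<longlongrightarrow> lyapunov A0 X0) F"
    unfolding G_def by (simp add: LIM_zero_iff)
qed

section \<open>Derivative of the Lyapunov solution along curves\<close>

lemma has_vector_derivative_iff_quotient:
  "(f has_vector_derivative f') (at t) \<longleftrightarrow>
   ((\<lambda>s. (1 / (s - t)) *\<^sub>R (f s - f t)) \<longlongrightarrow> f') (at t)"
proof -
  have "norm ((f s - f t) - (s - t) *\<^sub>R f') / norm (s - t)
      = norm ((1 / (s - t)) *\<^sub>R (f s - f t) - f')" if "s \<noteq> t" for s
  proof -
    have "(1 / (s - t)) *\<^sub>R (f s - f t) - f' = (1 / (s - t)) *\<^sub>R ((f s - f t) - (s - t) *\<^sub>R f')"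
      using that by (simp add: scaleR_diff_right)
    then show ?thesis by (simp add: divide_inverse mult.commute)
  qed
  then have "((\<lambda>s. norm ((f s - f t) - (s - t) *\<^sub>R f') / norm (s - t)) \<longlongrightarrow> 0) (at t)
      \<longleftrightarrow> ((\<lambda>s. norm ((1 / (s - t)) *\<^sub>R (f s - f t) - f')) \<longlongrightarrow> 0) (at t)"
    by (intro filterlim_cong) (auto simp: eventually_at_filter)
  then show ?thesis
    by (simp add: has_vector_derivative_def has_derivative_iff_norm bounded_linear_scaleR_left
        tendsto_norm_zero_iff LIM_zero_iff)
qed

text \<open>Differentiating \<open>A G + G A = X\<close> gives a Lyapunov equation for
  \<open>G'\<close>. The difference quotients satisfy an exact discrete version of it, so
  differentiability of the solution follows from \<open>tendsto_lyapunov\<close>.\<close>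

lemma has_vector_derivative_lyapunov:
  fixes A X :: "real \<Rightarrow> real^'n^'n"
  assumes A: "(A has_vector_derivative A') (at t)" and X: "(X has_vector_derivative X') (at t)"
    and inj: "inj (anticomm (A t))"
  shows "((\<lambda>s. lyapunov (A s) (X s)) has_vector_derivative
      lyapunov (A t) (X' - anticomm A' (lyapunov (A t) (X t)))) (at t)"
proof -
  define G where "G = lyapunov (A t) (X t)"
  have lim: "(A \<longlongrightarrow> A t) (at t)"
    using has_vector_derivative_continuous[OF A] by (simp add: continuous_at)
  let ?dA = "\<lambda>s. (1 / (s - t)) *\<^sub>R (A s - A t)" and ?dX = "\<lambda>s. (1 / (s - t)) *\<^sub>R (X s - X t)"
  have dA: "(?dA \<longlongrightarrow> A') (at t)" and dX: "(?dX \<longlongrightarrow> X') (at t)"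
    using A X by (simp_all add: has_vector_derivative_iff_quotient)
  have "((\<lambda>s. lyapunov (A s) (?dX s - anticomm (?dA s) G)) \<longlongrightarrow>
      lyapunov (A t) (X' - anticomm A' G)) (at t)"
    unfolding anticomm_def
    by (intro tendsto_lyapunov lim inj tendsto_intros dA dX matrix_mult.tendsto)
  moreover have "eventually (\<lambda>s. (1 / (s - t)) *\<^sub>R (lyapunov (A s) (X s) - G)
      = lyapunov (A s) (?dX s - anticomm (?dA s) G)) (at t)"
    \<comment> \<open>\<open>eventually_inj_anticomm\<close> also carries a convergent right-hand
      side; the constant \<open>0\<close> fills that place.\<close>
    using eventually_inj_anticomm[OF lim tendsto_const[of 0] inj]
  proof eventually_elim
    case (elim s)
    have "X t = anticomm (A t) G"
      by (simp add: G_def anticomm_lyapunov[OF inj])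
    then have "anticomm (A s) ((1 / (s - t)) *\<^sub>R (lyapunov (A s) (X s) - G))
        = ?dX s - anticomm (?dA s) G"
      by (simp add: anticomm_scaleR anticomm_diff anticomm_lyapunov[OF elim])
        (simp add: anticomm_def matrix_ring_simps algebra_simps)
    then show ?case
      by (rule lyapunov_unique[OF elim, symmetric])
  qed
  ultimately show ?thesis
    unfolding has_vector_derivative_iff_quotient G_def
    by (subst filterlim_cong[OF refl refl]) auto
qed

subsection \<open>The Wasserstein metric and its connection\<close>

text \<open>By cyclicity of the trace, \<open>anticomm A\<close> is self-adjoint for the form
  \<open>trace (X ** Y)\<close>; hence so is its inverse.\<close>

lemma trace_lyapunov_self_adjoint:
  fixes A X Y :: "real^'n^'n"
  assumes "inj (anticomm A)"
  shows "trace (lyapunov A X ** Y) = trace (X ** lyapunov A Y)"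
proof -
  define x y where "x = lyapunov A X" and "y = lyapunov A Y"
  have X: "X = A ** x + x ** A" and Y: "Y = A ** y + y ** A"
    using anticomm_lyapunov[OF assms] by (simp_all add: x_def y_def anticomm_def)
  have "trace (x ** (A ** y + y ** A)) = trace ((A ** x + x ** A) ** y)"
    using trace_mul_sym[of A "x ** y"] by (simp add: matrix_ring_simps trace_add)
  then show ?thesis
    unfolding x_def[symmetric] y_def[symmetric] by (simp add: X Y)
qed

text \<open>Transposition and cyclicity give \<open>tr (y A x) = tr (y x A)\<close>, so each is half
  of \<open>tr (y X)\<close>. In this form \<open>lyapunov\<close> occurs only once, which suits
  differentiation in \<open>A\<close>.\<close>

lemma wasserstein_eq:
  fixes A X Y :: "real^'n^'n"
  assumes A: "A \<in> lyapunov_regular" and "X \<in> Sym" "Y \<in> Sym"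
  shows "wasserstein A X Y = trace (lyapunov A Y ** X) / 2"
proof -
  define x y where "x = lyapunov A X" and "y = lyapunov A Y"
  have sym: "A \<in> Sym" "x \<in> Sym" "y \<in> Sym" and inj: "inj (anticomm A)"
    using assms by (auto simp: x_def y_def lyapunov_in_Sym lyapunov_regular_def)
  have X: "X = A ** x + x ** A"
    using anticomm_lyapunov[OF inj] by (simp add: x_def anticomm_def)
  have "trace (y ** A ** x) = trace (transpose (y ** A ** x))"
    by (simp add: trace_transpose)
  also have "\<dots> = trace (y ** x ** A)"
    using sym trace_mul_sym[of "x ** A" y]
    by (simp add: matrix_transpose_mul Sym_transpose matrix_mul_assoc)
  finally show ?thesis
    unfolding wasserstein_def x_def[symmetric] y_def[symmetric]
    by (simp add: X matrix_ring_simps trace_add)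
qed

lemma wasserstein_commute:
  fixes A X Y :: "real^'n^'n"
  assumes "A \<in> lyapunov_regular" "X \<in> Sym" "Y \<in> Sym"
  shows "wasserstein A X Y = wasserstein A Y X"
proof -
  have "trace (lyapunov A Y ** X) = trace (Y ** lyapunov A X)"
    using assms by (intro trace_lyapunov_self_adjoint) (simp add: lyapunov_regular_def)
  also have "\<dots> = trace (lyapunov A X ** Y)"
    by (rule trace_mul_sym)
  finally show ?thesis
    using assms by (simp add: wasserstein_eq)
qed

text \<open>The test vector is \<open>anticomm A X\<close>: its Lyapunov solution is
  \<open>X\<close>, so the pairing is half the squared norm of \<open>X\<close>.\<close>

lemma wasserstein_nondegenerate:
  fixes A X :: "real^'n^'n"
  assumes A: "A \<in> lyapunov_regular" and X: "X \<in> Sym"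
    and zero: "\<And>Y. Y \<in> Sym \<Longrightarrow> wasserstein A X Y = 0"
  shows "X = 0"
proof -
  have "A \<in> Sym" and inj: "inj (anticomm A)"
    using A by (auto simp: lyapunov_regular_def)
  then have "anticomm A X \<in> Sym"
    by (simp add: anticomm_def Sym_anticommutator X)
  then have "trace (X ** X) = 0"
    using zero[of "anticomm A X"] by (simp add: wasserstein_eq A X lyapunov_unique[OF inj refl])
  then show ?thesis
    using trace_transpose_mult_self[of X] X by (simp add: Sym_transpose)
qed

text \<open>Relative openness along symmetric directions: formulas proved only on
  \<open>lyapunov_regular\<close> may be differentiated there.\<close>

lemma eventually_regular:
  fixes A H :: "real^'n^'n"
  assumes "A \<in> lyapunov_regular" "H \<in> Sym"
  shows "eventually (\<lambda>t. A + t *\<^sub>R H \<in> lyapunov_regular) (nhds 0)"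
proof -
  have "((\<lambda>t. A + t *\<^sub>R H) \<longlongrightarrow> A + 0 *\<^sub>R H) (nhds 0)"
    by (intro tendsto_intros filterlim_ident)
  then have "eventually (\<lambda>t. inj (anticomm (A + t *\<^sub>R H))) (nhds 0)"
    using assms
    by (intro eventually_inj_anticomm[OF _ tendsto_const[of 0]]) (auto simp: lyapunov_regular_def)
  then show ?thesis
    by eventually_elim (use assms in \<open>auto simp: lyapunov_regular_def intro!: Sym_intros\<close>)
qed

section \<open>Derivative of the metric and the Levi-Civita connection\<close>

lemma dir_deriv_eqI:
  assumes "eventually (\<lambda>t. f (p + t *\<^sub>R x) = h t) (nhds 0)"
    and "(h has_vector_derivative d) (at 0)"
  shows "dir_deriv f p x = d"
proof -
  have "((\<lambda>t. f (p + t *\<^sub>R x)) has_vector_derivative d) (at 0)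
      \<longleftrightarrow> (h has_vector_derivative d) (at 0)"
    using assms(1) eventually_nhds_x_imp_x[OF assms(1)]
    by (intro has_vector_derivative_cong_ev) (auto elim: eventually_mono)
  then show ?thesis
    using assms(2) unfolding dir_deriv_def by (auto intro: vector_derivative_at)
qed

lemma has_vector_derivative_line: "((\<lambda>t. p + t *\<^sub>R x) has_vector_derivative x) (at t)"
  by (auto intro!: derivative_eq_intros)

text \<open>The derivative of \<open>lyapunov A Z\<close> in direction \<open>X\<close> is
  \<open>- lyapunov A (anticomm X z)\<close>; self-adjointness then moves \<open>lyapunov A\<close>
  onto \<open>Y\<close>.\<close>

lemma dir_deriv_wasserstein:
  fixes A X Y Z :: "real^'n^'n"
  assumes A: "A \<in> lyapunov_regular" and sym: "X \<in> Sym" "Y \<in> Sym" "Z \<in> Sym"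
  shows "dir_deriv (\<lambda>q. wasserstein q Y Z) A X
    = - trace (X ** anticomm (lyapunov A Y) (lyapunov A Z)) / 2"
proof (rule dir_deriv_eqI)
  define y z where "y = lyapunov A Y" and "z = lyapunov A Z"
  have inj: "inj (anticomm A)"
    using A by (simp add: lyapunov_regular_def)
  show "eventually (\<lambda>t. wasserstein (A + t *\<^sub>R X) Y Z
      = trace (lyapunov (A + t *\<^sub>R X) Z ** Y) / 2) (nhds 0)"
    using eventually_regular[OF A \<open>X \<in> Sym\<close>]
    by eventually_elim (simp add: wasserstein_eq sym)
  have "((\<lambda>t. lyapunov (A + t *\<^sub>R X) Z) has_vector_derivative
      lyapunov A (0 - anticomm X z)) (at 0)"
    using has_vector_derivative_lyapunov[OF has_vector_derivative_line has_vector_derivative_const,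
        where t = 0] inj by (simp add: z_def)
  from bounded_linear.has_vector_derivative[OF bounded_linear_trace
      bounded_linear.has_vector_derivative[OF matrix_mult.bounded_linear_left this]]
  have "((\<lambda>t. trace (lyapunov (A + t *\<^sub>R X) Z ** Y)) has_vector_derivative
      trace (lyapunov A (0 - anticomm X z) ** Y)) (at 0)" .
  moreover have "trace (lyapunov A (0 - anticomm X z) ** Y) = trace ((0 - anticomm X z) ** y)"
    by (simp add: trace_lyapunov_self_adjoint[OF inj] y_def)
  moreover have "\<dots> = - trace (X ** anticomm y z)"
    using trace_mul_sym[of z "X ** y"]
    by (simp add: anticomm_def matrix_ring_simps trace_add trace_sub trace_minus)
  ultimately have "((\<lambda>t. trace (lyapunov (A + t *\<^sub>R X) Z ** Y)) has_vector_derivative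
      - trace (X ** anticomm y z)) (at 0)"
    by simp
  then show "((\<lambda>t. trace (lyapunov (A + t *\<^sub>R X) Z ** Y) / 2) has_vector_derivative
      - trace (X ** anticomm y z) / 2) (at 0)"
    by (rule has_vector_derivative_divide)
qed

text \<open>The difference of two connections, lowered by the metric to \<open>T\<close>, is
  symmetric in its first two arguments and antisymmetric in its last two, hence zero.\<close>

lemma levi_civita_at_unique:
  assumes V: "subspace V"
    and commute: "\<And>x y. x \<in> V \<Longrightarrow> y \<in> V \<Longrightarrow> g p x y = g p y x"
    and diff: "\<And>x y z. x \<in> V \<Longrightarrow> y \<in> V \<Longrightarrow> z \<in> V \<Longrightarrow> g p (x - y) z = g p x z - g p y z"
    and nondegenerate: "\<And>x. x \<in> V \<Longrightarrow> (\<And>z. z \<in> V \<Longrightarrow> g p x z = 0) \<Longrightarrow> x = 0"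
    and C: "levi_civita_at V g p C" and C': "levi_civita_at V g p C'"
    and xy: "x \<in> V" "y \<in> V"
  shows "C x y = C' x y"
proof -
  define T where "T = (\<lambda>x y z. g p (C x y - C' x y) z)"
  have LC: "D x y \<in> V \<and> D x y = D y x" if "levi_civita_at V g p D" "x \<in> V" "y \<in> V" for D x y
    using that unfolding levi_civita_at_def by blast
  note in_V = LC[OF C] LC[OF C']
  have compat: "g p (D x y) z + g p y (D x z) = dir_deriv (\<lambda>q. g q y z) p x"
    if "levi_civita_at V g p D" "x \<in> V" "y \<in> V" "z \<in> V" for D x y z
    using that unfolding levi_civita_at_def by simp
  have swap12: "T x y z = T y x z" if "x \<in> V" "y \<in> V" for x y z
    unfolding T_def using in_V[OF that] by presburger
  have swap23: "T x y z = - T x z y" if "x \<in> V" "y \<in> V" "z \<in> V" for x y z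
  proof -
    have "g p (C x y) z + g p y (C x z) = g p (C' x y) z + g p y (C' x z)"
      using that by (simp only: compat[OF C] compat[OF C'])
    moreover have "g p y (C x z) = g p (C x z) y" "g p y (C' x z) = g p (C' x z) y"
      using that in_V by (blast intro: commute)+
    ultimately show ?thesis
      unfolding T_def using that in_V by (simp add: diff)
  qed
  \<comment> \<open>Alternating the two exchanges three times each returns to \<open>T x y z\<close>
    with the opposite sign.\<close>
  have "T x y z = 0" if z: "z \<in> V" for z
    using swap12[OF xy, of z] swap23[OF xy(2,1) z] swap12[OF xy(2) z, of x] swap23[OF z xy(2,1)]
      swap12[OF z xy(1), of y] swap23[OF xy(1) z xy(2)] by linarith
  then have "C x y - C' x y = 0"
    using in_V[OF xy] unfolding T_def by (intro nondegenerate subspace_diff[OF V]) blast+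
  then show ?thesis by simp
qed

definition wasserstein_christoffel :: "real^'n^'n \<Rightarrow> real^'n^'n \<Rightarrow> real^'n^'n \<Rightarrow> real^'n^'n" where
  "wasserstein_christoffel A X Y =
     - (lyapunov A X ** A ** lyapunov A Y + lyapunov A Y ** A ** lyapunov A X)"

lemma wasserstein_christoffel_in_Sym:
  "A \<in> lyapunov_regular \<Longrightarrow> X \<in> Sym \<Longrightarrow> Y \<in> Sym \<Longrightarrow> wasserstein_christoffel A X Y \<in> Sym"
  unfolding wasserstein_christoffel_def
  by (intro Sym_minus Sym_sandwich lyapunov_in_Sym) (auto simp: lyapunov_regular_def)

lemma wasserstein_christoffel_commute:
  "wasserstein_christoffel A X Y = wasserstein_christoffel A Y X"
  by (simp add: wasserstein_christoffel_def)

text \<open>With \<open>X = A x + x A\<close>, the trace in \<open>dir_deriv_wasserstein\<close>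
  becomes four words in \<open>A\<close>, \<open>x\<close>, \<open>y\<close>, \<open>z\<close>. Up
  to cyclic rotation, two belong to each connection term.\<close>

lemma levi_civita_wasserstein:
  fixes A :: "real^'n^'n"
  assumes A: "A \<in> lyapunov_regular"
  shows "levi_civita_at Sym wasserstein A (wasserstein_christoffel A)"
  unfolding levi_civita_at_def
proof (intro conjI ballI)
  fix X Y Z :: "real^'n^'n" assume sym: "X \<in> Sym" "Y \<in> Sym" "Z \<in> Sym"
  have inj: "inj (anticomm A)"
    using A by (simp add: lyapunov_regular_def)
  define x y z where "x = lyapunov A X" and "y = lyapunov A Y" and "z = lyapunov A Z"
  have X: "X = A ** x + x ** A"
    using anticomm_lyapunov[OF inj] by (simp add: x_def anticomm_def)
  have "wasserstein A (wasserstein_christoffel A X Y) Z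
      = - trace (z ** (x ** A ** y + y ** A ** x)) / 2"
    by (simp add: wasserstein_eq A sym wasserstein_christoffel_in_Sym)
      (simp add: wasserstein_christoffel_def x_def y_def z_def matrix_ring_simps trace_add
        trace_sub trace_minus)
  moreover have "wasserstein A Y (wasserstein_christoffel A X Z)
      = - trace (y ** (x ** A ** z + z ** A ** x)) / 2"
    by (subst wasserstein_commute, simp_all add: wasserstein_eq A sym wasserstein_christoffel_in_Sym)
      (simp add: wasserstein_christoffel_def x_def y_def z_def matrix_ring_simps trace_add
        trace_sub trace_minus)
  moreover have "trace (X ** anticomm y z)
      = trace (z ** (x ** A ** y + y ** A ** x)) + trace (y ** (x ** A ** z + z ** A ** x))"
    using trace_mul_sym[of "x ** A ** y" z] trace_mul_sym[of "A ** x" "z ** y"]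
      trace_mul_sym[of "x ** A ** z" y] trace_mul_sym[of "A ** x" "y ** z"]
    by (simp add: X anticomm_def matrix_ring_simps trace_add)
  ultimately show "dir_deriv (\<lambda>q. wasserstein q Y Z) A X =
      wasserstein A (wasserstein_christoffel A X Y) Z
      + wasserstein A Y (wasserstein_christoffel A X Z)"
    by (simp add: dir_deriv_wasserstein A sym y_def z_def field_simps)
qed (auto simp: wasserstein_christoffel_in_Sym A intro: wasserstein_christoffel_commute)

text \<open>Stated on all of \<open>lyapunov_regular\<close>, so that the formula holds near
  \<open>A\<close> when the curvature differentiates it.\<close>

lemma christoffel_wasserstein:
  fixes A X Y :: "real^'n^'n"
  assumes A: "A \<in> lyapunov_regular" and "X \<in> Sym" "Y \<in> Sym"
  shows "christoffel Sym wasserstein A X Y = wasserstein_christoffel A X Y"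
  unfolding christoffel_def
proof (rule the_equality)
  show "\<exists>C. levi_civita_at Sym wasserstein A C \<and> wasserstein_christoffel A X Y = C X Y"
    using levi_civita_wasserstein[OF A] by blast
next
  fix W assume "\<exists>C. levi_civita_at Sym wasserstein A C \<and> W = C X Y"
  then obtain C where C: "levi_civita_at Sym wasserstein A C" and W: "W = C X Y" by blast
  show "W = wasserstein_christoffel A X Y"
    unfolding W
  proof (rule levi_civita_at_unique[OF subspace_Sym _ _ _ C levi_civita_wasserstein[OF A]])
    show "wasserstein A (x - y) z = wasserstein A x z - wasserstein A y z"
      if "x \<in> Sym" "y \<in> Sym" "z \<in> Sym" for x y z
      using that A
      by (simp add: wasserstein_eq Sym_diff matrix_mult.diff_right trace_sub diff_divide_distrib)
  qed (use assms wasserstein_commute[OF A] wasserstein_nondegenerate[OF A] in auto)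
qed

text \<open>The product rule in the base point, in direction \<open>H\<close> with \<open>X\<close>
  and \<open>Y\<close> fixed. Here \<open>x'\<close> and \<open>y'\<close> are the derivatives of
  \<open>lyapunov A X\<close> and \<open>lyapunov A Y\<close>.\<close>

definition wasserstein_christoffel_deriv ::
    "real^'n^'n \<Rightarrow> real^'n^'n \<Rightarrow> real^'n^'n \<Rightarrow> real^'n^'n \<Rightarrow> real^'n^'n" where
  "wasserstein_christoffel_deriv A H X Y =
    (let x = lyapunov A X; x' = - lyapunov A (anticomm H x);
         y = lyapunov A Y; y' = - lyapunov A (anticomm H y)
     in - (x' ** A ** y + x ** H ** y + x ** A ** y' + (y' ** A ** x + y ** H ** x + y ** A ** x')))"

lemma has_vector_derivative_christoffel:
  fixes A X Y :: "real \<Rightarrow> real^'n^'n"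
  assumes A: "(A has_vector_derivative A') (at t)"
    and X: "(X has_vector_derivative X') (at t)" and Y: "(Y has_vector_derivative Y') (at t)"
    and inj: "inj (anticomm (A t))"
  shows "((\<lambda>s. wasserstein_christoffel (A s) (X s) (Y s)) has_vector_derivative
      wasserstein_christoffel_deriv (A t) A' (X t) (Y t)
      + wasserstein_christoffel (A t) X' (Y t) + wasserstein_christoffel (A t) (X t) Y') (at t)"
  unfolding wasserstein_christoffel_def
  by (rule has_vector_derivative_eq_rhs,
      (rule has_vector_derivative_minus has_vector_derivative_add matrix_mult.has_vector_derivative
        has_vector_derivative_lyapunov assms)+)
    (simp add: wasserstein_christoffel_deriv_def Let_def linear_diff[OF linear_lyapunov[OF inj]]
      matrix_ring_simps)

text \<open>The usual coordinate expression; the bracket of constant fields vanishes. The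
  derivatives of the connection stay unexpanded because one of them cancels in
  \<open>J'_deriv\<close>.\<close>

lemma curvature_wasserstein:
  fixes A X Y Z :: "real^'n^'n"
  assumes A: "A \<in> lyapunov_regular" and sym: "X \<in> Sym" "Y \<in> Sym" "Z \<in> Sym"
  shows "curvature Sym wasserstein A X Y Z =
    wasserstein_christoffel_deriv A X Y Z
    + wasserstein_christoffel A X (wasserstein_christoffel A Y Z)
    - (wasserstein_christoffel_deriv A Y X Z
      + wasserstein_christoffel A Y (wasserstein_christoffel A X Z))"
proof -
  have inj: "inj (anticomm A)"
    using A by (simp add: lyapunov_regular_def)
  have dir_deriv_const: "dir_deriv (\<lambda>_. c) p h = 0" for c p h :: "real^'n^'n"
    by (simp add: dir_deriv_def)
  have nabla_const: "nabla Sym wasserstein (\<lambda>_. H) (\<lambda>_. K) q = christoffel Sym wasserstein q H K"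
    for H K q :: "real^'n^'n"
    by (simp add: nabla_def dir_deriv_const)
  have 1: "nabla Sym wasserstein (\<lambda>_. H) (nabla Sym wasserstein (\<lambda>_. K) (\<lambda>_. Z)) A
      = wasserstein_christoffel_deriv A H K Z
        + wasserstein_christoffel A H (wasserstein_christoffel A K Z)"
    if "H \<in> Sym" "K \<in> Sym" for H K
  proof -
    have "dir_deriv (nabla Sym wasserstein (\<lambda>_. K) (\<lambda>_. Z)) A H
        = wasserstein_christoffel_deriv A H K Z"
    proof (rule dir_deriv_eqI)
      show "eventually (\<lambda>t. nabla Sym wasserstein (\<lambda>_. K) (\<lambda>_. Z) (A + t *\<^sub>R H)
          = wasserstein_christoffel (A + t *\<^sub>R H) K Z) (nhds 0)"
        using eventually_regular[OF A \<open>H \<in> Sym\<close>]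
        by eventually_elim (simp add: nabla_const christoffel_wasserstein that sym)
      show "((\<lambda>t. wasserstein_christoffel (A + t *\<^sub>R H) K Z) has_vector_derivative
          wasserstein_christoffel_deriv A H K Z) (at 0)"
        using has_vector_derivative_christoffel[OF has_vector_derivative_line
            has_vector_derivative_const has_vector_derivative_const, of A 0 H K Z] inj
        by (simp add: wasserstein_christoffel_def linear_0[OF linear_lyapunov[OF inj]]
            matrix_mult.zero_left matrix_mult.zero_right)
    qed
    then show ?thesis
      using that sym A
      by (simp add: nabla_def[of _ _ "\<lambda>_. H"] nabla_const[of K Z] christoffel_wasserstein
          wasserstein_christoffel_in_Sym)
  qed
  have 2: "nabla Sym wasserstein (lie_bracket (\<lambda>_. X) (\<lambda>_. Y)) (\<lambda>_. Z) A = 0"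
    using sym A inj
    by (simp add: nabla_def dir_deriv_const lie_bracket_def christoffel_wasserstein Sym_zero
        wasserstein_christoffel_def linear_0[OF linear_lyapunov] matrix_mult.zero_left
        matrix_mult.zero_right)
  show ?thesis
    by (simp add: curvature_def curvature_field_def 1 2 sym)
qed

subsection \<open>Linear differential equations\<close>

text \<open>On the compact segment from \<open>t0\<close> to \<open>t\<close> the coefficient is at
  most some \<open>K\<close>, so the squared norm of \<open>Y\<close> with an exponential weight is
  monotone and cannot leave \<open>0\<close>.\<close>

lemma gronwall_zero:
  fixes Y :: "real \<Rightarrow> 'a::real_inner"
  assumes I: "is_interval I" and deriv: "\<And>t. t \<in> I \<Longrightarrow> (Y has_vector_derivative Y' t) (at t)"
    and bound: "\<And>t. t \<in> I \<Longrightarrow> norm (Y' t) \<le> c t * norm (Y t)"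
    and c: "continuous_on I c" and t0: "t0 \<in> I" "Y t0 = 0" and t: "t \<in> I"
  shows "Y t = 0"
proof -
  have sub: "closed_segment t0 t \<subseteq> I"
    using I t t0 by (meson closed_segment_subset is_interval_convex)
  then obtain K where K: "c s \<le> K" if "s \<in> closed_segment t0 t" for s
    using continuous_attains_sup[of "closed_segment t0 t" c] continuous_on_subset[OF c sub]
    by (metis compact_segment ends_in_segment(1) empty_iff)
  \<comment> \<open>The exponent stays free: \<open>- (2 * K)\<close> serves to the right of
    \<open>t0\<close>, \<open>2 * K\<close> to the left.\<close>
  define u where "u = (\<lambda>\<kappa> s. (Y s \<bullet> Y s) * exp (\<kappa> * s))"
  have u: "DERIV (u \<kappa>) s :> (2 * (Y s \<bullet> Y' s) + \<kappa> * (Y s \<bullet> Y s)) * exp (\<kappa> * s)"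
    and u_bound: "\<bar>2 * (Y s \<bullet> Y' s)\<bar> \<le> 2 * K * (Y s \<bullet> Y s)"
    if "s \<in> closed_segment t0 t" for \<kappa> s
  proof -
    have "s \<in> I" using that sub by blast
    have "((\<lambda>s. Y s \<bullet> Y s) has_vector_derivative (Y s \<bullet> Y' s + Y' s \<bullet> Y s)) (at s)"
      by (intro bounded_bilinear.has_vector_derivative[OF bounded_bilinear_inner] deriv \<open>s \<in> I\<close>)
    then have "DERIV (\<lambda>s. Y s \<bullet> Y s) s :> 2 * (Y s \<bullet> Y' s)"
      by (simp add: has_real_derivative_iff_has_vector_derivative inner_commute)
    then show "DERIV (u \<kappa>) s :> (2 * (Y s \<bullet> Y' s) + \<kappa> * (Y s \<bullet> Y s)) * exp (\<kappa> * s)"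
      unfolding u_def by (auto intro!: derivative_eq_intros simp: algebra_simps)
    have "\<bar>Y s \<bullet> Y' s\<bar> \<le> norm (Y s) * norm (Y' s)"
      by (rule Cauchy_Schwarz_ineq2)
    also have "\<dots> \<le> norm (Y s) * (K * norm (Y s))"
      by (intro mult_left_mono order.trans[OF bound[OF \<open>s \<in> I\<close>]] mult_right_mono K that) auto
    finally show "\<bar>2 * (Y s \<bullet> Y' s)\<bar> \<le> 2 * K * (Y s \<bullet> Y s)"
      by (simp add: dot_square_norm power2_eq_square abs_mult mult_ac)
  qed
  show ?thesis
  proof (cases "t0 \<le> t")
    case True
    have "u (- (2 * K)) t \<le> u (- (2 * K)) t0"
    proof (rule DERIV_nonpos_imp_nonincreasing[OF True])
      fix s assume "t0 \<le> s" "s \<le> t"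
      then have s: "s \<in> closed_segment t0 t" by (simp add: closed_segment_eq_real_ivl)
      show "\<exists>y. DERIV (u (- (2 * K))) s :> y \<and> y \<le> 0"
        using u[OF s, of "- (2 * K)"] u_bound[OF s]
        by (intro exI conjI) (auto intro!: mult_nonpos_nonneg)
    qed
    then show ?thesis
      using t0 inner_ge_zero[of "Y t"] by (auto simp: u_def mult_le_0_iff intro: order.antisym)
  next
    case False
    have "u (2 * K) t \<le> u (2 * K) t0"
    proof (rule DERIV_nonneg_imp_nondecreasing[of t t0])
      fix s assume "t \<le> s" "s \<le> t0"
      then have s: "s \<in> closed_segment t0 t" by (simp add: closed_segment_eq_real_ivl)
      show "\<exists>y. DERIV (u (2 * K)) s :> y \<and> 0 \<le> y"
        using u[OF s, of "2 * K"] u_bound[OF s]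
        by (intro exI conjI) auto
    qed (use False in simp)
    then show ?thesis
      using t0 inner_ge_zero[of "Y t"] by (auto simp: u_def mult_le_0_iff intro: order.antisym)
  qed
qed

text \<open>Asking for a norm bound instead of an equation covers both
  \<open>k' = - (k x + x k)\<close> and \<open>J' = J x + x J\<close>.\<close>

lemma anticomm_ode_zero:
  fixes Y x :: "real \<Rightarrow> real^'n^'n"
  assumes I: "is_interval I" and deriv: "\<And>t. t \<in> I \<Longrightarrow> (Y has_vector_derivative Y' t) (at t)"
    and bound: "\<And>t. t \<in> I \<Longrightarrow> norm (Y' t) \<le> norm (anticomm (Y t) (x t))"
    and x: "continuous_on I x" and t0: "t0 \<in> I" "Y t0 = 0" and t: "t \<in> I"
  shows "Y t = 0"
proof -
  obtain K where K: "norm (P ** Q) \<le> norm P * norm Q * K" for P Q :: "real^'n^'n"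
    using matrix_mult.bounded by blast
  have "norm (anticomm P Q) \<le> 2 * K * norm Q * norm P" for P Q :: "real^'n^'n"
    unfolding anticomm_def using K[of P Q] K[of Q P] by (intro norm_triangle_le) (simp add: mult_ac)
  then show ?thesis
    by (intro gronwall_zero[OF I deriv _ _ t0 t, of "\<lambda>t. 2 * K * norm (x t)"]
        order.trans[OF bound] continuous_intros x)
qed

lemma wasserstein_christoffel_linear_right:
  assumes "inj (anticomm A)"
  shows "wasserstein_christoffel A X (Y + Z)
      = wasserstein_christoffel A X Y + wasserstein_christoffel A X Z"
    and "wasserstein_christoffel A X (- Y) = - wasserstein_christoffel A X Y"
  by (simp_all add: wasserstein_christoffel_def linear_add[OF linear_lyapunov[OF assms]]
      linear_neg[OF linear_lyapunov[OF assms]] matrix_ring_simps)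

lemma wasserstein_christoffel_deriv_commute:
  "wasserstein_christoffel_deriv A H X Y = wasserstein_christoffel_deriv A H Y X"
  by (simp add: wasserstein_christoffel_deriv_def Let_def add.commute)

text \<open>Transposition fixes the curve near \<open>t\<close>, hence its derivative. This supplies
  the symmetry of \<open>velocity \<gamma> t\<close> and \<open>J' t\<close>, on which the explicit
  connection formula depends.\<close>

lemma vector_derivative_in_Sym:
  fixes \<gamma> :: "real \<Rightarrow> real^'n^'n"
  assumes "open I" "t \<in> I" "\<gamma> ` I \<subseteq> Sym" "(\<gamma> has_vector_derivative d) (at t)"
  shows "d \<in> Sym"
proof -
  have "((\<lambda>s. transpose (\<gamma> s)) has_vector_derivative transpose d) (at t)"
    using bounded_linear.has_vector_derivative[OF bounded_linear_transpose assms(4)] .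
  then have "(\<gamma> has_vector_derivative transpose d) (at t)"
    by (rule has_vector_derivative_transform_within_open[OF _ assms(1,2)])
      (use assms(3) in \<open>auto simp: Sym_def\<close>)
  then have "d = transpose d"
    by (rule vector_derivative_unique_at[OF assms(4)])
  then show ?thesis
    unfolding Sym_def by (intro CollectI) (rule sym)
qed

subsection \<open>Jacobi fields\<close>

locale wasserstein_jacobi =
  fixes I :: "real set" and \<gamma> J :: "real \<Rightarrow> real^'n^'n"
  assumes geodesic: "geodesic Sym SPD wasserstein I \<gamma>"
    and jacobi: "jacobi_field Sym wasserstein I \<gamma> J"
begin

definition J' :: "real \<Rightarrow> real^'n^'n" where
  "J' t = vector_derivative J (at t)"

definition x :: "real \<Rightarrow> real^'n^'n" where
  "x t = lyapunov (\<gamma> t) (velocity \<gamma> t)"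

text \<open>The variation of \<open>x\<close> in the direction of the Jacobi field.\<close>

definition k :: "real \<Rightarrow> real^'n^'n" where
  "k t = lyapunov (\<gamma> t) (J' t - anticomm (J t) (x t))"

lemma
  shows open_I: "open I" and interval_I: "is_interval I"
    and \<gamma>_SPD: "t \<in> I \<Longrightarrow> \<gamma> t \<in> SPD"
    and \<gamma>_deriv: "t \<in> I \<Longrightarrow> (\<gamma> has_vector_derivative velocity \<gamma> t) (at t)"
    and J_Sym: "t \<in> I \<Longrightarrow> J t \<in> Sym"
    and J_deriv: "t \<in> I \<Longrightarrow> (J has_vector_derivative J' t) (at t)"
  using geodesic jacobi
  by (auto simp: geodesic_def jacobi_field_def velocity_def J'_def vector_derivative_works)

lemma \<gamma>_regular: "t \<in> I \<Longrightarrow> \<gamma> t \<in> lyapunov_regular"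
  by (rule SPD_imp_regular[OF \<gamma>_SPD])

lemma \<gamma>_inj: "t \<in> I \<Longrightarrow> inj (anticomm (\<gamma> t))"
  using \<gamma>_regular by (simp add: lyapunov_regular_def)

lemma velocity_Sym: "t \<in> I \<Longrightarrow> velocity \<gamma> t \<in> Sym"
  using \<gamma>_SPD by (intro vector_derivative_in_Sym[OF open_I _ _ \<gamma>_deriv]) (auto simp: SPD_def)

lemma J'_Sym: "t \<in> I \<Longrightarrow> J' t \<in> Sym"
  by (intro vector_derivative_in_Sym[OF open_I _ _ J_deriv]) (auto simp: J_Sym)

section \<open>The geodesic and Jacobi equations as explicit second-order equations\<close>

lemma velocity_deriv:
  assumes "t \<in> I"
  shows "(velocity \<gamma> has_vector_derivative
    - wasserstein_christoffel (\<gamma> t) (velocity \<gamma> t) (velocity \<gamma> t)) (at t)"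
proof -
  have "vector_derivative (velocity \<gamma>) (at t)
      + wasserstein_christoffel (\<gamma> t) (velocity \<gamma> t) (velocity \<gamma> t) = 0"
    using geodesic assms
    by (simp add: geodesic_def cov_deriv_along_def christoffel_wasserstein \<gamma>_regular velocity_Sym)
  moreover have "(velocity \<gamma> has_vector_derivative vector_derivative (velocity \<gamma>) (at t)) (at t)"
    using geodesic assms by (simp add: geodesic_def vector_derivative_works[symmetric])
  ultimately show ?thesis
    by (simp add: add_eq_0_iff2)
qed

text \<open>This is the geodesic equation linearised along \<open>J\<close>: the connection is
  varied in both velocity slots and in its base point.\<close>

lemma J'_deriv:
  assumes t: "t \<in> I"
  shows "(J' has_vector_derivative
    - (wasserstein_christoffel (\<gamma> t) (velocity \<gamma> t) (J' t)
       + wasserstein_christoffel (\<gamma> t) (velocity \<gamma> t) (J' t)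
       + wasserstein_christoffel_deriv (\<gamma> t) (J t) (velocity \<gamma> t) (velocity \<gamma> t))) (at t)"
proof -
  let ?C = "wasserstein_christoffel (\<gamma> t)" and ?dC = "wasserstein_christoffel_deriv (\<gamma> t)"
    and ?X = "velocity \<gamma> t" and ?D = "cov_deriv_along Sym wasserstein \<gamma> J"
  have D_eq: "?D s = J' s + wasserstein_christoffel (\<gamma> s) (velocity \<gamma> s) (J s)" if "s \<in> I" for s
    by (simp add: cov_deriv_along_def J'_def christoffel_wasserstein \<gamma>_regular velocity_Sym J_Sym that)
  have D_Sym: "?D t \<in> Sym"
    using t by (simp add: D_eq Sym_add J'_Sym wasserstein_christoffel_in_Sym \<gamma>_regular velocity_Sym J_Sym)
  define D' where "D' = vector_derivative ?D (at t)"
  have "(?D has_vector_derivative D') (at t)"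
    using jacobi t by (simp add: jacobi_field_def D'_def vector_derivative_works[symmetric])
  moreover note has_vector_derivative_christoffel[OF \<gamma>_deriv velocity_deriv J_deriv \<gamma>_inj, OF t t t t]
  \<comment> \<open>Differentiability of \<open>J'\<close> is obtained here: on \<open>I\<close> it
    is the covariant derivative of \<open>J\<close> minus the connection term, and both are
    differentiable.\<close>
  ultimately have "((\<lambda>s. ?D s - wasserstein_christoffel (\<gamma> s) (velocity \<gamma> s) (J s))
      has_vector_derivative
        D' - (?dC ?X ?X (J t) + ?C (- ?C ?X ?X) (J t) + ?C ?X (J' t))) (at t)"
    by (rule has_vector_derivative_diff)
  then have J': "(J' has_vector_derivative
      D' - (?dC ?X ?X (J t) + ?C (- ?C ?X ?X) (J t) + ?C ?X (J' t))) (at t)"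
    by (rule has_vector_derivative_transform_within_open[OF _ open_I t]) (simp add: D_eq)
  have "cov_deriv_along Sym wasserstein \<gamma> ?D t
      + curvature Sym wasserstein (\<gamma> t) (J t) ?X ?X = 0"
    using jacobi t by (simp add: jacobi_field_def)
  then have "D' + ?C ?X (?D t) + curvature Sym wasserstein (\<gamma> t) (J t) ?X ?X = 0"
    using t
    by (simp add: cov_deriv_along_def[of _ _ _ ?D] D'_def christoffel_wasserstein
        \<gamma>_regular velocity_Sym D_Sym)
  then have "D' + (?C ?X (J' t + ?C ?X (J t)) + (?dC (J t) ?X ?X + ?C (J t) (?C ?X ?X)
      - (?dC ?X (J t) ?X + ?C ?X (?C (J t) ?X)))) = 0"
    using t by (simp add: D_eq curvature_wasserstein \<gamma>_regular velocity_Sym J_Sym add.assoc)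
  then have D': "D' = - (?C ?X (J' t + ?C ?X (J t)) + (?dC (J t) ?X ?X + ?C (J t) (?C ?X ?X)
      - (?dC ?X (J t) ?X + ?C ?X (?C (J t) ?X))))"
    by (simp only: eq_neg_iff_add_eq_0)
  \<comment> \<open>By symmetry of the connection, its iterated terms from the curvature and from
    the two covariant derivatives cancel, as do the base-point derivatives along
    \<open>?X\<close>.\<close>
  have "?C (- ?C ?X ?X) (J t) = - ?C (J t) (?C ?X ?X)"
    by (subst wasserstein_christoffel_commute)
      (rule wasserstein_christoffel_linear_right[OF \<gamma>_inj[OF t]])
  moreover have "?C ?X (J' t + ?C ?X (J t)) = ?C ?X (J' t) + ?C ?X (?C (J t) ?X)"
    by (subst wasserstein_christoffel_commute[of _ "J t"])
      (rule wasserstein_christoffel_linear_right[OF \<gamma>_inj[OF t]])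
  ultimately have "D' - (?dC ?X ?X (J t) + ?C (- ?C ?X ?X) (J t) + ?C ?X (J' t))
      = - (?C ?X (J' t) + ?C ?X (J' t) + ?dC (J t) ?X ?X)"
    by (simp add: D' wasserstein_christoffel_deriv_commute[of _ _ "J t" ?X])
  then show ?thesis
    using has_vector_derivative_eq_rhs[OF J'] by blast
qed

section \<open>The first-order equations for \<open>x\<close>, \<open>J\<close> and
  \<open>k\<close>\<close>

lemma velocity_eq: "t \<in> I \<Longrightarrow> velocity \<gamma> t = \<gamma> t ** x t + x t ** \<gamma> t"
  unfolding x_def using anticomm_lyapunov[OF \<gamma>_inj] by (simp add: anticomm_def)

lemma J'_eq:
  assumes "t \<in> I"
  shows "J' t = J t ** x t + x t ** J t + (\<gamma> t ** k t + k t ** \<gamma> t)"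
proof -
  have "anticomm (\<gamma> t) (k t) = J' t - anticomm (J t) (x t)"
    unfolding k_def using anticomm_lyapunov[OF \<gamma>_inj[OF assms]] by blast
  then show ?thesis by (simp add: anticomm_def algebra_simps)
qed

text \<open>The acceleration is \<open>2 x \<gamma> x\<close>. It cancels the mixed terms of
  \<open>anticomm (velocity \<gamma> t) (x t)\<close> and leaves
  \<open>- anticomm (\<gamma> t) (x t ** x t)\<close>.\<close>

lemma x_deriv:
  assumes t: "t \<in> I"
  shows "(x has_vector_derivative - (x t ** x t)) (at t)"
proof -
  have "lyapunov (\<gamma> t) (- wasserstein_christoffel (\<gamma> t) (velocity \<gamma> t) (velocity \<gamma> t)
      - anticomm (velocity \<gamma> t) (x t)) = - (x t ** x t)"
    by (rule lyapunov_unique[OF \<gamma>_inj[OF t]])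
      (simp add: wasserstein_christoffel_def x_def[symmetric],
        simp add: anticomm_def velocity_eq[OF t] matrix_ring_simps algebra_simps)
  then show ?thesis
    using has_vector_derivative_lyapunov[OF \<gamma>_deriv velocity_deriv \<gamma>_inj, OF t t t]
    by (simp add: x_def[symmetric])
qed

text \<open>This linearises \<open>x_deriv\<close>: varying \<open>x\<close> by \<open>k\<close> in
  \<open>- x ** x\<close> gives \<open>- (k x + x k)\<close>. It is verified by differentiating the
  Lyapunov equation of \<open>k\<close>.\<close>

lemma k_deriv:
  assumes t: "t \<in> I"
  shows "(k has_vector_derivative - anticomm (k t) (x t)) (at t)"
proof -
  \<comment> \<open>\<open>J'_deriv\<close> contains the two parts of \<open>k\<close> separately:
    \<open>w\<close> enters through the connection, \<open>v\<close> through its base-point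
    derivative.\<close>
  define w v where "w = lyapunov (\<gamma> t) (J' t)" and "v = lyapunov (\<gamma> t) (anticomm (J t) (x t))"
  have k: "k t = w - v"
    by (simp add: k_def w_def v_def linear_diff[OF linear_lyapunov[OF \<gamma>_inj[OF t]]])
  \<comment> \<open>\<open>J'_deriv\<close> gives \<open>2 S + 2 R\<close> as derivative of
    \<open>J'\<close>; in \<open>Q = S + R\<close> the parts \<open>w\<close> and \<open>v\<close>
    recombine into \<open>k\<close>.\<close>
  define S R where "S = x t ** \<gamma> t ** w + w ** \<gamma> t ** x t"
    and "R = x t ** J t ** x t - (v ** \<gamma> t ** x t + x t ** \<gamma> t ** v)"
  define Q where "Q = k t ** \<gamma> t ** x t + x t ** J t ** x t + x t ** \<gamma> t ** k t"
  have "wasserstein_christoffel (\<gamma> t) (velocity \<gamma> t) (J' t) = - S"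
    by (simp add: wasserstein_christoffel_def S_def w_def x_def)
  moreover have "wasserstein_christoffel_deriv (\<gamma> t) (J t) (velocity \<gamma> t) (velocity \<gamma> t) = - (R + R)"
  proof -
    have E: "- v ** \<gamma> t ** x t + x t ** J t ** x t + x t ** \<gamma> t ** - v = R"
      by (simp only: R_def matrix_mult.minus_left matrix_mult.minus_right) (simp add: algebra_simps)
    then show ?thesis
      unfolding wasserstein_christoffel_deriv_def Let_def x_def[symmetric] v_def[symmetric]
      by (simp only: E)
  qed
  moreover have "Q = S + R"
    unfolding Q_def S_def R_def k matrix_mult.diff_left matrix_mult.diff_right
    by (simp add: algebra_simps)
  ultimately have "(J' has_vector_derivative Q + Q) (at t)"
    by (intro has_vector_derivative_eq_rhs[OF J'_deriv[OF t]]) simp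
  moreover have "((\<lambda>s. anticomm (J s) (x s)) has_vector_derivative
      anticomm (J' t) (x t) + anticomm (J t) (- (x t ** x t))) (at t)"
    unfolding anticomm_def
    by (rule has_vector_derivative_eq_rhs,
        (rule has_vector_derivative_add matrix_mult.has_vector_derivative J_deriv[OF t] x_deriv[OF t])+)
      (simp add: algebra_simps)
  ultimately have "((\<lambda>s. J' s - anticomm (J s) (x s)) has_vector_derivative
      Q + Q - (anticomm (J' t) (x t) + anticomm (J t) (- (x t ** x t)))) (at t)"
    by (rule has_vector_derivative_diff)
  from has_vector_derivative_lyapunov[OF \<gamma>_deriv[OF t] this \<gamma>_inj[OF t]]
  have "(k has_vector_derivative lyapunov (\<gamma> t)
      (Q + Q - (anticomm (J' t) (x t) + anticomm (J t) (- (x t ** x t)))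
        - anticomm (velocity \<gamma> t) (k t))) (at t)"
    by (simp add: k_def[symmetric])
  moreover have "lyapunov (\<gamma> t)
      (Q + Q - (anticomm (J' t) (x t) + anticomm (J t) (- (x t ** x t)))
        - anticomm (velocity \<gamma> t) (k t)) = - anticomm (k t) (x t)"
    by (rule lyapunov_unique[OF \<gamma>_inj[OF t]])
      (simp add: Q_def anticomm_def velocity_eq[OF t] J'_eq[OF t] matrix_ring_simps algebra_simps)
  ultimately show ?thesis by simp
qed

lemma x_continuous: "continuous_on I x"
  using has_vector_derivative_continuous[OF x_deriv] by (auto intro: continuous_at_imp_continuous_on)

lemma k_Sym: "t \<in> I \<Longrightarrow> k t \<in> Sym"
  unfolding k_def x_def anticomm_def
  by (intro lyapunov_in_Sym \<gamma>_regular Sym_diff Sym_anticommutator J'_Sym J_Sym velocity_Sym)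

text \<open>
  The terms of \<open>J'\<close> and \<open>k'\<close> that involve \<open>x\<close> cancel under the trace, so \<open>tr (J k)\<close> increases
  strictly wherever \<open>k\<close> does not vanish.
\<close>

lemma trace_J_k_deriv:
  assumes t: "t \<in> I"
  shows "DERIV (\<lambda>s. trace (J s ** k s)) t :> 2 * trace (transpose (k t) ** \<gamma> t ** k t)"
proof -
  have "trace (J t ** - anticomm (k t) (x t) + J' t ** k t) = 2 * trace (k t ** \<gamma> t ** k t)"
    using trace_mul_sym[of "J t ** k t" "x t"] trace_mul_sym[of "\<gamma> t ** k t" "k t"]
    by (simp add: anticomm_def J'_eq[OF t] matrix_ring_simps trace_add trace_sub trace_minus)
  moreover have "((\<lambda>s. trace (J s ** k s)) has_vector_derivative
      trace (J t ** - anticomm (k t) (x t) + J' t ** k t)) (at t)"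
    by (intro bounded_linear.has_vector_derivative[OF bounded_linear_trace]
        matrix_mult.has_vector_derivative J_deriv k_deriv t)
  ultimately show ?thesis
    using k_Sym[OF t] by (simp add: has_real_derivative_iff_has_vector_derivative Sym_transpose)
qed

theorem no_conjugate_points:
  assumes "a \<in> I" "b \<in> I" "a < b" "J a = 0" "J b = 0" "t \<in> I"
  shows "J t = 0"
proof -
  have sub: "s \<in> I" if "a \<le> s" "s \<le> b" for s
    using mem_is_interval_1_I[OF interval_I assms(1,2)] that by blast
  \<comment> \<open>Both end values are \<open>0\<close>, so the mean value theorem yields a point
    where the derivative of \<open>trace (J s ** k s)\<close> vanishes.\<close>
  obtain c where c: "a < c" "c < b"
    and "trace (J b ** k b) - trace (J a ** k a)
      = (b - a) * (2 * trace (transpose (k c) ** \<gamma> c ** k c))"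
    using MVT2[OF \<open>a < b\<close> trace_J_k_deriv[OF sub]] by blast
  then have trace: "trace (transpose (k c) ** \<gamma> c ** k c) = 0"
    using assms by (simp add: matrix_mult.zero_left trace_zero)
  have "c \<in> I"
    using sub c by simp
  have "k c = 0"
    using trace_congruence_pos[OF \<gamma>_SPD[OF \<open>c \<in> I\<close>], of "k c"] trace by (metis less_irrefl)
  have k: "k s = 0" if "s \<in> I" for s
    by (rule anticomm_ode_zero[OF interval_I k_deriv _ x_continuous \<open>c \<in> I\<close> \<open>k c = 0\<close> that])
      simp_all
  \<comment> \<open>With \<open>k\<close> zero on all of \<open>I\<close>, \<open>J'_eq\<close>
    reduces to a homogeneous linear equation for \<open>J\<close>.\<close>
  have bound: "norm (J' s) \<le> norm (anticomm (J s) (x s))" if "s \<in> I" for s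
    using that by (simp add: J'_eq k matrix_mult.zero_left matrix_mult.zero_right anticomm_def)
  show ?thesis
    by (rule anticomm_ode_zero[OF interval_I J_deriv bound x_continuous \<open>a \<in> I\<close> \<open>J a = 0\<close> \<open>t \<in> I\<close>])
qed

end

theorem theorem5p2:
  "\<not> (\<exists>(I :: real set) (\<gamma> :: real \<Rightarrow> real^'n^'n) (J :: real \<Rightarrow> real^'n^'n) a b.
        geodesic Sym SPD wasserstein I \<gamma> \<and>
        jacobi_field Sym wasserstein I \<gamma> J \<and>
        (\<exists>t\<in>I. J t \<noteq> 0) \<and>
        a \<in> I \<and> b \<in> I \<and> a \<noteq> b \<and> J a = 0 \<and> J b = 0)"
proof (intro notI, elim exE conjE bexE)
  fix I :: "real set" and \<gamma> J :: "real \<Rightarrow> real^'n^'n" and a b t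
  assume "geodesic Sym SPD wasserstein I \<gamma>" "jacobi_field Sym wasserstein I \<gamma> J"
  then interpret wasserstein_jacobi I \<gamma> J
    by unfold_locales
  assume *: "a \<in> I" "b \<in> I" "a \<noteq> b" "J a = 0" "J b = 0" "t \<in> I" "J t \<noteq> 0"
  consider "a < b" | "b < a"
    using \<open>a \<noteq> b\<close> by linarith
  then show False
    by cases (use * no_conjugate_points in blast)+
qed

end
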